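(* Let $\mathbb{F}$ be a field with $\mathrm{char}(\mathbb{F})=0$, $\mathsf{R}=\mathbb{F}[x]$, and $0\neq h\in\mathsf{R}$. View $\mathsf{A}_h$ as a subalgebra of the Weyl algebra $\mathsf{A}_1$ via the embedding $x\mapsto x$, $\hat y\mapsto yh$. Suppose $\mathsf{M}$ is an irreducible $\mathsf{R}$-torsion-free $\mathsf{A}_1$-module. The following conditions are equivalent: (i) The restriction of $\mathsf{M}$ to $\mathsf{A}_h$ is an irreducible $\mathsf{A}_h$-module. (ii) $\mathsf{Soc}_{\mathsf{A}_h}(\mathsf{M})\neq 0$. (iii) $h\mathsf{M}=\mathsf{M}$ and $\mathsf{M}$ is a Noetherian $\mathsf{A}_h$-module.
   Context: $\mathsf{A}_h$ is the unital associative $\mathbb{F}$-algebra with generators $x,\hat y$ and defining relation $\hat yx=x\hat y+h$; throughout $h\neq 0$. The Weyl algebra $\mathsf{A}_1$ has generators $x,y$ with $[y,x]=yx-xy=1$. Both contain $\mathsf{R}=\mathbb{F}[x]$ as a subalgebra. Modules are left modules. A module $\mathsf{M}$ is $\mathsf{R}$-torsion-free if $rv=0$ with $r\in\mathsf{R}$, $v\in\mathsf{M}$ implies $r=0$ or $v=0$. $\mathsf{Soc}_{\mathsf{A}_h}(\mathsf{M})$ is the submodule of $\mathsf{M}$ generated by its irreducible $\mathsf{A}_h$-submodules. *)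

theory Defs
  imports
    "HOL-Library.Poly_Mapping"
    "HOL-Computational_Algebra.Polynomial"
    "HOL-Algebra.QuotRing"
    "HOL-Algebra.Module"
begin

section \<open>Left modules over a not necessarily commutative ring\<close>

text \<open>
  The axioms are those of the locale \<^locale>\<open>module\<close>, whose ring of scalars is commutative.
  The predicate \<^const>\<open>submodule\<close> makes no such assumption and is used as it is.
\<close>

locale left_module = R?: ring R + M?: abelian_group M
  for R (structure) and M (structure) +
  assumes smult_closed [simp, intro]:
      "\<lbrakk>a \<in> carrier R; v \<in> carrier M\<rbrakk> \<Longrightarrow> a \<odot>\<^bsub>M\<^esub> v \<in> carrier M"
    and smult_l_distr:
      "\<lbrakk>a \<in> carrier R; b \<in> carrier R; v \<in> carrier M\<rbrakk>
        \<Longrightarrow> (a \<oplus> b) \<odot>\<^bsub>M\<^esub> v = a \<odot>\<^bsub>M\<^esub> v \<oplus>\<^bsub>M\<^esub> b \<odot>\<^bsub>M\<^esub> v"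
    and smult_r_distr:
      "\<lbrakk>a \<in> carrier R; v \<in> carrier M; w \<in> carrier M\<rbrakk>
        \<Longrightarrow> a \<odot>\<^bsub>M\<^esub> (v \<oplus>\<^bsub>M\<^esub> w) = a \<odot>\<^bsub>M\<^esub> v \<oplus>\<^bsub>M\<^esub> a \<odot>\<^bsub>M\<^esub> w"
    and smult_assoc1:
      "\<lbrakk>a \<in> carrier R; b \<in> carrier R; v \<in> carrier M\<rbrakk>
        \<Longrightarrow> (a \<otimes> b) \<odot>\<^bsub>M\<^esub> v = a \<odot>\<^bsub>M\<^esub> (b \<odot>\<^bsub>M\<^esub> v)"
    and smult_one [simp]:
      "v \<in> carrier M \<Longrightarrow> \<one> \<odot>\<^bsub>M\<^esub> v = v"

locale irreducible_module = left_module +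
  assumes nontrivial: "carrier M \<noteq> {\<zero>\<^bsub>M\<^esub>}"
    and submodule_trivial:
      "submodule N R M \<Longrightarrow> N = {\<zero>\<^bsub>M\<^esub>} \<or> N = carrier M"

locale noetherian_module = left_module +
  assumes ascending_chain_condition:
    "\<And>N :: nat \<Rightarrow> _ set. \<lbrakk>\<And>i. submodule (N i) R M; \<And>i. N i \<subseteq> N (Suc i)\<rbrakk>
      \<Longrightarrow> \<exists>n. \<forall>m\<ge>n. N m = N n"

definition generated_submodule ::
    "('r, 's) ring_scheme \<Rightarrow> ('r, 'm, 't) module_scheme \<Rightarrow> 'm set \<Rightarrow> 'm set"
  where "generated_submodule R M S = \<Inter>{N. submodule N R M \<and> S \<subseteq> N}"

definition socle :: "('r, 's) ring_scheme \<Rightarrow> ('r, 'm, 't) module_scheme \<Rightarrow> 'm set"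
  where "socle R M = generated_submodule R M
    (\<Union>{N. submodule N R M \<and> irreducible_module R (M\<lparr>carrier := N\<rparr>)})"

definition restrict_scalars ::
    "('r \<Rightarrow> 's) \<Rightarrow> ('s, 'm) module \<Rightarrow> ('r, 'm) module"
  where "restrict_scalars \<phi> M =
    \<lparr>carrier = carrier M, mult = mult M, one = one M, zero = zero M, add = add M,
     smult = (\<lambda>a v. \<phi> a \<odot>\<^bsub>M\<^esub> v)\<rparr>"

lemma left_module_restrict_scalars:
  assumes "ring R" "left_module S M" "\<phi> \<in> ring_hom R S"
  shows "left_module R (restrict_scalars \<phi> M)"
proof -
  interpret S: left_module S M by fact
  interpret R: ring R by fact
  have ab: "abelian_group (restrict_scalars \<phi> M)"
    by (rule abelian_groupI)
      (auto simp: restrict_scalars_def S.M.a_assoc S.M.a_comm S.M.a_lcomm intro: S.M.l_neg exI[of _ "\<ominus>\<^bsub>M\<^esub> _"]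
        bexI[of _ "\<ominus>\<^bsub>M\<^esub> _"])
  show ?thesis
    by (intro left_module.intro left_module_axioms.intro ab R.ring_axioms)
      (use assms(3) in \<open>auto simp: restrict_scalars_def ring_hom_closed[OF assms(3)]
        ring_hom_add[OF assms(3)] ring_hom_mult[OF assms(3)] ring_hom_one[OF assms(3)]
        S.smult_l_distr S.smult_r_distr S.smult_assoc1\<close>)
qed


section \<open>The free algebra on two generators\<close>

datatype gen = GX | GY

datatype xy_word = Word (letters: "gen list")

instantiation xy_word :: monoid_add
begin

definition "0 = Word []"
definition "u + v = Word (letters u @ letters v)"

instance
  by standard (simp_all add: zero_xy_word_def plus_xy_word_def)

end

text \<open>
  Finitely supported functions on the free monoid of words, with the convolution product
  of \<^theory>\<open>HOL-Library.Poly_Mapping\<close>, form the free unital associative algebra.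
\<close>

type_synonym 'a free_alg = "xy_word \<Rightarrow>\<^sub>0 'a"

definition free_const :: "'a \<Rightarrow> ('a::field) free_alg"
  where "free_const c = Poly_Mapping.single 0 c"

definition free_gen :: "gen \<Rightarrow> ('a::field) free_alg"
  where "free_gen g = Poly_Mapping.single (Word [g]) 1"

abbreviation free_X :: "('a::field) free_alg" where "free_X \<equiv> free_gen GX"
abbreviation free_Y :: "('a::field) free_alg" where "free_Y \<equiv> free_gen GY"

definition free_poly :: "('a::field) poly \<Rightarrow> 'a free_alg"
  where "free_poly p = (\<Sum>i\<le>degree p. free_const (coeff p i) * free_X ^ i)"

definition free_subst :: "(gen \<Rightarrow> 'a free_alg) \<Rightarrow> ('a::field) free_alg \<Rightarrow> 'a free_alg"
  where "free_subst f p =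
    (\<Sum>w\<in>Poly_Mapping.keys p. free_const (Poly_Mapping.lookup p w) * prod_list (map f (letters w)))"

definition free_ring :: "('a::field) free_alg ring"
  where "free_ring = \<lparr>carrier = UNIV, mult = (*), one = 1, zero = 0, add = (+)\<rparr>"


section \<open>The algebras \<open>A\<^sub>h\<close>\<close>

definition A_ideal :: "('a::field) poly \<Rightarrow> 'a free_alg set"
  where "A_ideal h = Idl\<^bsub>free_ring\<^esub> {free_Y * free_X - (free_X * free_Y + free_poly h)}"

definition A_alg :: "('a::field) poly \<Rightarrow> 'a free_alg set ring"
  where "A_alg h = free_ring Quot (A_ideal h)"

definition A_class :: "('a::field) poly \<Rightarrow> 'a free_alg \<Rightarrow> 'a free_alg set"
  where "A_class h p = A_ideal h +>\<^bsub>free_ring\<^esub> p"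

abbreviation A_x :: "('a::field) poly \<Rightarrow> 'a free_alg set"
  where "A_x h \<equiv> A_class h free_X"

abbreviation A_y :: "('a::field) poly \<Rightarrow> 'a free_alg set"
  where "A_y h \<equiv> A_class h free_Y"

definition A_of_poly :: "('a::field) poly \<Rightarrow> 'a poly \<Rightarrow> 'a free_alg set"
  where "A_of_poly h r = A_class h (free_poly r)"

abbreviation weyl :: "('a::field) free_alg set ring"
  where "weyl \<equiv> A_alg 1"

text \<open>
  The embedding of \<open>A\<^sub>h\<close> into the Weyl algebra is induced by the substitution
  \<open>x \<mapsto> x\<close>, \<open>y \<mapsto> y h(x)\<close> of the free algebra.  This substitution is constant modulo the
  Weyl relation on each residue class, by lemma \<open>A_embed_class\<close> below, so that
  \<^const>\<open>the_elem\<close> is applied to a singleton.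
\<close>

definition A_embed :: "('a::field) poly \<Rightarrow> 'a free_alg set \<Rightarrow> 'a free_alg set"
  where "A_embed h C = the_elem
    ((\<lambda>p. A_class 1 (free_subst (case_gen free_X (free_Y * free_poly h)) p)) ` C)"

definition torsion_free :: "(('a::field) free_alg set, 'm) module \<Rightarrow> bool"
  where "torsion_free M \<longleftrightarrow>
    (\<forall>r. \<forall>v\<in>carrier M. A_of_poly 1 r \<odot>\<^bsub>M\<^esub> v = \<zero>\<^bsub>M\<^esub> \<longrightarrow> r = 0 \<or> v = \<zero>\<^bsub>M\<^esub>)"


subsection \<open>The embedding is a well-defined homomorphism\<close>

lemma ring_free_ring: "ring (free_ring :: ('a::field) free_alg ring)"
  by (rule ringI; (rule abelian_groupI | rule monoidI)?)
    (auto simp: free_ring_def algebra_simps intro: exI[of _ "- _"])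

lemma free_const_add: "free_const (a + b) = free_const a + free_const b"
  by (simp add: free_const_def single_add)

lemma free_const_mult: "free_const (a * b) = free_const a * free_const b"
  by (simp add: free_const_def mult_single)

lemma free_const_0 [simp]: "free_const 0 = 0"
  by (simp add: free_const_def)

lemma free_const_1 [simp]: "free_const 1 = 1"
  by (simp add: free_const_def)

lemma free_alg_induct [case_names single sum]:
  fixes p :: "('a::field) free_alg"
  assumes "\<And>w c. P (Poly_Mapping.single w c)"
    and "\<And>p q. P p \<Longrightarrow> P q \<Longrightarrow> P (p + q)"
  shows "P p"
proof (induction p rule: update_induct)
  case const
  show ?case using assms(1)[of 0 0] by simp
next
  case (update p w c)
  have "Poly_Mapping.update w c p = p + Poly_Mapping.single w c"
    using update(1) by (intro poly_mapping_eqI)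
      (auto simp: lookup_update lookup_add lookup_single in_keys_iff when_def)
  then show ?case using update(3) assms by simp
qed

lemma free_const_commute: "free_const c * p = p * free_const c"
proof (induction p rule: free_alg_induct)
  case (single w a)
  then show ?case by (simp add: free_const_def mult_single mult.commute)
next
  case (sum p q)
  then show ?case by (simp add: algebra_simps)
qed

lemma free_poly_commute_X: "free_poly r * free_X = free_X * free_poly r"
  unfolding free_poly_def sum_distrib_left sum_distrib_right
  by (intro sum.cong refl) (metis free_const_commute mult.assoc power_commutes)

lemma free_subst_superset:
  assumes "finite W" "Poly_Mapping.keys p \<subseteq> W"
  shows "free_subst f p = (\<Sum>w\<in>W. free_const (Poly_Mapping.lookup p w) * prod_list (map f (letters w)))"
  unfolding free_subst_def
  by (rule sum.mono_neutral_left) (use assms in \<open>auto simp: in_keys_iff\<close>)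

lemma free_subst_add: "free_subst f (p + q) = free_subst f p + free_subst f q"
  using keys_add[of p q]
  by (simp add: free_subst_superset[of "Poly_Mapping.keys p \<union> Poly_Mapping.keys q"] lookup_add free_const_add
      distrib_right sum.distrib)

lemma free_subst_single:
  "free_subst f (Poly_Mapping.single w c) = free_const c * prod_list (map f (letters w))"
  by (simp add: free_subst_superset[of "{w}"])

lemma free_subst_mult: "free_subst f (p * q) = free_subst f p * free_subst f q"
proof (induction p rule: free_alg_induct)
  case (single u a)
  show ?case
  proof (induction q rule: free_alg_induct)
    case (single v b)
    have "free_const a * free_const b * (s * t) = free_const a * s * (free_const b * t)"
      for s t :: "'a free_alg"
      using free_const_commute[of b s] by (metis mult.assoc)
    then show ?case
      by (simp add: mult_single free_subst_single plus_xy_word_def free_const_mult)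
  next
    case (sum q q')
    then show ?case by (simp add: distrib_left free_subst_add)
  qed
next
  case (sum p p')
  then show ?case by (simp add: distrib_right free_subst_add)
qed

lemma free_subst_const [simp]: "free_subst f (free_const c) = free_const c"
  unfolding free_const_def[of c]
  by (simp add: free_subst_single zero_xy_word_def) (simp add: free_const_def zero_xy_word_def)

lemma free_subst_gen [simp]: "free_subst f (free_gen g) = f g"
  by (simp add: free_gen_def free_subst_single)

lemma free_subst_0 [simp]: "free_subst f 0 = 0"
  by (simp add: free_subst_def)

lemma free_subst_1 [simp]: "free_subst f 1 = 1"
  using free_subst_const[of f 1] by simp

lemma free_subst_uminus: "free_subst f (- p) = - free_subst f p"
  using free_subst_add[of f p "- p"] by (simp add: eq_neg_iff_add_eq_0 add.commute)

lemma free_subst_diff: "free_subst f (p - q) = free_subst f p - free_subst f q"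
  using free_subst_add[of f p "- q"] by (simp add: free_subst_uminus)

lemma free_subst_sum: "free_subst f (sum g I) = (\<Sum>i\<in>I. free_subst f (g i))"
  by (induction I rule: infinite_finite_induct) (simp_all add: free_subst_add)

lemma free_subst_power: "free_subst f (p ^ n) = free_subst f p ^ n"
  by (induction n) (simp_all add: free_subst_mult)

lemma free_subst_poly: "f GX = free_X \<Longrightarrow> free_subst f (free_poly r) = free_poly r"
  by (simp add: free_poly_def free_subst_sum free_subst_mult free_subst_power)

lemma free_subst_ring_hom: "free_subst f \<in> ring_hom free_ring free_ring"
  by (rule ring_hom_memI) (simp_all add: free_ring_def free_subst_mult free_subst_add)

lemma ideal_A_ideal: "ideal (A_ideal h) free_ring"
  unfolding A_ideal_def by (rule ring.genideal_ideal[OF ring_free_ring]) (simp add: free_ring_def)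

lemma ring_A: "ring (A_alg h)"
  unfolding A_alg_def by (rule ideal.quotient_is_ring[OF ideal_A_ideal])

lemma A_class_ring_hom: "A_class h \<in> ring_hom free_ring (A_alg h)"
  unfolding A_alg_def A_class_def[abs_def] by (rule ideal.rcos_ring_hom[OF ideal_A_ideal])

lemma carrier_A: "carrier (A_alg h) = range (A_class h)"
  by (auto simp: A_alg_def FactRing_def A_RCOSETS_def' A_class_def free_ring_def)

lemma A_class_add: "A_class h (p + q) = A_class h p \<oplus>\<^bsub>A_alg h\<^esub> A_class h q"
  using ring_hom_add[OF A_class_ring_hom] by (simp add: free_ring_def)

lemma A_class_mult: "A_class h (p * q) = A_class h p \<otimes>\<^bsub>A_alg h\<^esub> A_class h q"
  using ring_hom_mult[OF A_class_ring_hom] by (simp add: free_ring_def)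

lemma A_class_1: "A_class h 1 = \<one>\<^bsub>A_alg h\<^esub>"
  using ring_hom_one[OF A_class_ring_hom] by (simp add: free_ring_def)

lemma A_class_eq_iff: "A_class h p = A_class h q \<longleftrightarrow> p - q \<in> A_ideal h"
proof -
  interpret ideal "A_ideal h" free_ring by (rule ideal_A_ideal)
  have m: "a_minus free_ring p q = p - q" for p q :: "'a free_alg"
    using minus_equality[of "- q" q] by (simp add: a_minus_def free_ring_def)
  show ?thesis
    using quotient_eq_iff_same_a_r_cos[OF ideal_axioms, of p q]
    by (auto simp: A_class_def m) (simp_all add: free_ring_def)
qed

lemma mem_A_class:
  fixes p q :: "('a::field) free_alg"
  shows "q \<in> A_class h p \<longleftrightarrow> A_class h q = A_class h p"
proof -
  interpret ideal "A_ideal h" free_ring by (rule ideal_A_ideal)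
  have u: "x \<in> carrier free_ring" for x :: "'a free_alg"
    by (simp add: free_ring_def)
  show ?thesis
  proof
    assume "q \<in> A_class h p"
    then show "A_class h q = A_class h p"
      unfolding A_class_def by (rule a_repr_independence'[OF _ u, symmetric])
  next
    assume "A_class h q = A_class h p"
    moreover have "q \<in> A_class h q"
      unfolding A_class_def by (rule a_rcos_self[OF u])
    ultimately show "q \<in> A_class h p" by simp
  qed
qed

lemma A_relation: "A_y h \<otimes>\<^bsub>A_alg h\<^esub> A_x h = A_x h \<otimes>\<^bsub>A_alg h\<^esub> A_y h \<oplus>\<^bsub>A_alg h\<^esub> A_of_poly h h"
proof -
  have "free_Y * free_X - (free_X * free_Y + free_poly h) \<in> A_ideal h"
    unfolding A_ideal_def
    by (rule ring.genideal_self'[OF ring_free_ring]) (simp add: free_ring_def)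
  then show ?thesis
    by (simp add: A_of_poly_def flip: A_class_mult A_class_add A_class_eq_iff)
qed

lemma free_subst_A_ideal:
  fixes h :: "'a::field poly"
  assumes "p \<in> A_ideal h"
  shows "free_subst (case_gen free_X (free_Y * free_poly h)) p \<in> A_ideal 1"
proof -
  let ?s = "free_subst (case_gen free_X (free_Y * free_poly h))"
  let ?w = "free_Y * free_X - (free_X * free_Y + free_poly 1) :: 'a free_alg"
  interpret W: ideal "A_ideal 1" "free_ring :: 'a free_alg ring" by (rule ideal_A_ideal)
  interpret H: ring_hom_ring free_ring free_ring ?s
    by (rule ring_hom_ringI2[OF ring_free_ring ring_free_ring free_subst_ring_hom])
  have pre: "ideal {r \<in> carrier free_ring. ?s r \<in> A_ideal 1} free_ring"
    by (rule H.ideal_vimage[OF W.ideal_axioms])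
  have "free_poly 1 = (1 :: 'a free_alg)"
    by (simp add: free_poly_def)
  moreover have "free_Y * free_poly h * free_X = free_Y * free_X * free_poly h"
    by (simp add: mult.assoc free_poly_commute_X)
  ultimately have "?s (free_Y * free_X - (free_X * free_Y + free_poly h)) = ?w * free_poly h"
    by (simp add: free_subst_diff free_subst_add free_subst_mult free_subst_poly algebra_simps)
  moreover have "?w \<in> A_ideal 1"
    unfolding A_ideal_def
    by (rule ring.genideal_self'[OF ring_free_ring]) (simp add: free_ring_def)
  then have "?w * free_poly h \<in> A_ideal 1"
    using W.I_r_closed[of ?w "free_poly h"] by (simp add: free_ring_def)
  ultimately have "A_ideal h \<subseteq> {r \<in> carrier free_ring. ?s r \<in> A_ideal 1}"
    unfolding A_ideal_def[of h]
    by (intro ring.genideal_minimal[OF ring_free_ring pre]) (simp add: free_ring_def)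
  then show ?thesis using assms by auto
qed

lemma image_eq_singletonI:
  assumes "\<And>q. q \<in> C \<Longrightarrow> f q = c" "p \<in> C"
  shows "f ` C = {c}"
  using assms by force

lemma A_embed_class:
  "A_embed h (A_class h p) = A_class 1 (free_subst (case_gen free_X (free_Y * free_poly h)) p)"
proof -
  let ?s = "free_subst (case_gen free_X (free_Y * free_poly h))"
  have "A_class 1 (?s q) = A_class 1 (?s p)" if "q \<in> A_class h p" for q
    using free_subst_A_ideal[OF that[unfolded mem_A_class A_class_eq_iff]]
    unfolding A_class_eq_iff by (simp only: free_subst_diff)
  moreover have "p \<in> A_class h p"
    by (simp add: mem_A_class)
  ultimately have "(\<lambda>q. A_class 1 (?s q)) ` A_class h p = {A_class 1 (?s p)}"
    by (rule image_eq_singletonI)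
  then show ?thesis by (simp add: A_embed_def)
qed

lemma A_embed_ring_hom: "A_embed h \<in> ring_hom (A_alg h) weyl"
  by (rule ring_hom_memI)
    (auto simp: carrier_A A_embed_class free_subst_mult free_subst_add
      simp flip: A_class_mult A_class_add A_class_1)

lemma A_embed_of_poly: "A_embed h (A_of_poly h r) = A_of_poly 1 r"
  by (simp add: A_of_poly_def A_embed_class free_subst_poly)

lemma A_embed_x: "A_embed h (A_x h) = A_x 1"
  by (simp add: A_embed_class)

lemma A_embed_y: "A_embed h (A_y h) = A_y 1 \<otimes>\<^bsub>weyl\<^esub> A_of_poly 1 h"
  by (simp add: A_embed_class A_of_poly_def A_class_mult)

end

theory Submission
  imports Defs
begin

text \<open>
  The element \<open>h\<close> is normal in \<open>A\<^sub>h\<close>: since \<open>[y, h] = h h'\<close> there, \<open>A\<^sub>h h = h A\<^sub>h\<close>.  Hence for an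
  \<open>A\<^sub>h\<close>-submodule \<open>N\<close> of \<open>M\<close> both \<open>h N\<close> and \<open>{v. h v \<in> N}\<close> are \<open>A\<^sub>h\<close>-submodules.  If \<open>h N = N\<close>, then the
  Weyl generator \<open>y\<close> maps \<open>N = h N\<close> into \<open>(y h) N \<subseteq> N\<close>, so that \<open>N\<close> is a Weyl submodule, i.e. \<open>0\<close> or \<open>M\<close>.
  An irreducible \<open>N\<close> satisfies \<open>h N = N\<close> because \<open>h\<close> acts injectively.  If \<open>M\<close> is Noetherian and
  \<open>h M = M\<close>, the ascending chain of the \<open>{v. h\<^sup>k v \<in> N}\<close> stabilises at a submodule \<open>N'\<close> with
  \<open>h N' = N'\<close>, so that \<open>N' = M\<close> for \<open>N \<noteq> 0\<close>, and then \<open>M = h\<^sup>k M \<subseteq> N\<close>.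
\<close>

section \<open>Submodules of left modules\<close>

context left_module
begin

lemma smult_l_null [simp]: "v \<in> carrier M \<Longrightarrow> \<zero> \<odot>\<^bsub>M\<^esub> v = \<zero>\<^bsub>M\<^esub>"
  using smult_l_distr[of \<zero> \<zero> v] M.add.l_cancel_one'[of "\<zero> \<odot>\<^bsub>M\<^esub> v" "\<zero> \<odot>\<^bsub>M\<^esub> v"] by simp

lemma smult_r_null [simp]: "a \<in> carrier R \<Longrightarrow> a \<odot>\<^bsub>M\<^esub> \<zero>\<^bsub>M\<^esub> = \<zero>\<^bsub>M\<^esub>"
  using smult_r_distr[of a "\<zero>\<^bsub>M\<^esub>" "\<zero>\<^bsub>M\<^esub>"]
    M.add.l_cancel_one'[of "a \<odot>\<^bsub>M\<^esub> \<zero>\<^bsub>M\<^esub>" "a \<odot>\<^bsub>M\<^esub> \<zero>\<^bsub>M\<^esub>"] by simp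

lemma smult_uminus_one: "v \<in> carrier M \<Longrightarrow> (\<ominus> \<one>) \<odot>\<^bsub>M\<^esub> v = \<ominus>\<^bsub>M\<^esub> v"
  using smult_l_distr[of "\<ominus> \<one>" \<one> v] by (simp add: R.l_neg M.minus_equality)

text \<open>Closure under negation comes for free, because the additive inverse is the action of
  \<open>\<ominus> \<one>\<close>.\<close>

lemma submoduleI:
  assumes "N \<subseteq> carrier M" "\<zero>\<^bsub>M\<^esub> \<in> N"
    and "\<And>v w. \<lbrakk>v \<in> N; w \<in> N\<rbrakk> \<Longrightarrow> v \<oplus>\<^bsub>M\<^esub> w \<in> N"
    and "\<And>a v. \<lbrakk>a \<in> carrier R; v \<in> N\<rbrakk> \<Longrightarrow> a \<odot>\<^bsub>M\<^esub> v \<in> N"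
  shows "submodule N R M"
proof -
  have "\<ominus>\<^bsub>M\<^esub> v \<in> N" if "v \<in> N" for v
    using assms(1) assms(4)[of "\<ominus> \<one>" v] that smult_uminus_one[of v] by auto
  then show ?thesis
    using assms by (intro submodule.intro submodule_axioms.intro subgroup.intro)
      (auto simp: a_inv_def)
qed

lemma submoduleD:
  assumes "submodule N R M"
  shows "N \<subseteq> carrier M" "\<zero>\<^bsub>M\<^esub> \<in> N"
    and "\<And>v w. \<lbrakk>v \<in> N; w \<in> N\<rbrakk> \<Longrightarrow> v \<oplus>\<^bsub>M\<^esub> w \<in> N"
    and "\<And>a v. \<lbrakk>a \<in> carrier R; v \<in> N\<rbrakk> \<Longrightarrow> a \<odot>\<^bsub>M\<^esub> v \<in> N"
proof -
  interpret N: submodule N R M by fact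
  show "N \<subseteq> carrier M" "\<zero>\<^bsub>M\<^esub> \<in> N" using N.subset N.one_closed by auto
  show "\<And>v w. \<lbrakk>v \<in> N; w \<in> N\<rbrakk> \<Longrightarrow> v \<oplus>\<^bsub>M\<^esub> w \<in> N" using N.m_closed by simp
  show "\<And>a v. \<lbrakk>a \<in> carrier R; v \<in> N\<rbrakk> \<Longrightarrow> a \<odot>\<^bsub>M\<^esub> v \<in> N" by (rule N.smult_closed)
qed

lemma submodule_zero: "submodule {\<zero>\<^bsub>M\<^esub>} R M"
  by (rule submoduleI) auto

lemma submodule_carrier: "submodule (carrier M) R M"
  by (rule submoduleI) auto

text \<open>Without irreducible submodules the generating set of the socle is empty, and the
  intersection of all submodules is zero.\<close>

lemma socle_nonzero_imp_irreducible_submodule: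
  assumes "socle R M \<noteq> {\<zero>\<^bsub>M\<^esub>}"
  obtains N where "submodule N R M" "irreducible_module R (M\<lparr>carrier := N\<rparr>)"
proof (rule ccontr)
  assume "\<not> thesis"
  then have "socle R M = \<Inter>{N. submodule N R M}"
    using that by (auto simp: socle_def generated_submodule_def)
  also have "\<dots> = {\<zero>\<^bsub>M\<^esub>}"
    using submodule_zero submoduleD(2) by blast
  finally show False using assms by contradiction
qed

end

lemma (in irreducible_module) socle_nonzero: "socle R M \<noteq> {\<zero>\<^bsub>M\<^esub>}"
proof -
  have "carrier M \<in> {N. submodule N R M \<and> irreducible_module R (M\<lparr>carrier := N\<rparr>)}"
    using submodule_carrier irreducible_module_axioms by simp
  then have "carrier M \<subseteq> socle R M"
    unfolding socle_def generated_submodule_def by blast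
  then show ?thesis using nontrivial M.zero_closed by blast
qed

text \<open>Only two submodules can occur in a chain: once the whole module is reached it persists,
  and if it is never reached all members are zero.\<close>

lemma (in irreducible_module) noetherian: "noetherian_module R M"
proof
  fix N :: "nat \<Rightarrow> _ set"
  assume N: "\<And>i. submodule (N i) R M" "\<And>i. N i \<subseteq> N (Suc i)"
  have mono: "N n \<subseteq> N m" if "n \<le> m" for n m
    using lift_Suc_mono_le[of N, OF N(2) that] .
  show "\<exists>n. \<forall>m\<ge>n. N m = N n"
  proof (cases "\<exists>n. N n = carrier M")
    case True
    then show ?thesis
      using mono submoduleD(1)[OF N(1)] by (metis subset_antisym)
  next
    case False
    then show ?thesis using submodule_trivial[OF N(1)] by metis
  qed
qed


section \<open>Normal elements\<close>

text \<open>Elementwise form of \<open>R z = z R\<close>. The first inclusion makes images of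
  submodules under \<open>z\<close> submodules, the second does so for preimages.\<close>

definition normal_element :: "('r, 's) ring_scheme \<Rightarrow> 'r \<Rightarrow> bool"
  where "normal_element R z \<longleftrightarrow> z \<in> carrier R \<and>
    (\<forall>a\<in>carrier R. \<exists>b\<in>carrier R. a \<otimes>\<^bsub>R\<^esub> z = z \<otimes>\<^bsub>R\<^esub> b) \<and>
    (\<forall>a\<in>carrier R. \<exists>b\<in>carrier R. z \<otimes>\<^bsub>R\<^esub> a = b \<otimes>\<^bsub>R\<^esub> z)"

context left_module
begin

lemma submodule_image_normal:
  assumes z: "normal_element R z" and N: "submodule N R M"
  shows "submodule ((\<lambda>v. z \<odot>\<^bsub>M\<^esub> v) ` N) R M"
proof (rule submoduleI)
  note ND = submoduleD[OF N]
  have zc: "z \<in> carrier R" using z by (simp add: normal_element_def)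
  show "(\<lambda>v. z \<odot>\<^bsub>M\<^esub> v) ` N \<subseteq> carrier M" using zc ND(1) by auto
  show "\<zero>\<^bsub>M\<^esub> \<in> (\<lambda>v. z \<odot>\<^bsub>M\<^esub> v) ` N"
    using zc ND(2) by (intro image_eqI[of _ _ "\<zero>\<^bsub>M\<^esub>"]) auto
  show "v \<oplus>\<^bsub>M\<^esub> w \<in> (\<lambda>v. z \<odot>\<^bsub>M\<^esub> v) ` N"
    if vw: "v \<in> (\<lambda>v. z \<odot>\<^bsub>M\<^esub> v) ` N" "w \<in> (\<lambda>v. z \<odot>\<^bsub>M\<^esub> v) ` N" for v w
  proof -
    obtain m n where mn: "m \<in> N" "v = z \<odot>\<^bsub>M\<^esub> m" "n \<in> N" "w = z \<odot>\<^bsub>M\<^esub> n"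
      using vw by blast
    have "v \<oplus>\<^bsub>M\<^esub> w = z \<odot>\<^bsub>M\<^esub> (m \<oplus>\<^bsub>M\<^esub> n)"
      using mn ND(1) by (auto simp: smult_r_distr[OF zc] subset_iff)
    then show ?thesis using ND(3)[OF mn(1,3)] by blast
  qed
  show "a \<odot>\<^bsub>M\<^esub> v \<in> (\<lambda>v. z \<odot>\<^bsub>M\<^esub> v) ` N"
    if a: "a \<in> carrier R" and "v \<in> (\<lambda>v. z \<odot>\<^bsub>M\<^esub> v) ` N" for a v
  proof -
    obtain n where n: "n \<in> N" "v = z \<odot>\<^bsub>M\<^esub> n" using \<open>v \<in> _\<close> by auto
    obtain b where b: "b \<in> carrier R" "a \<otimes> z = z \<otimes> b"
      using z a by (auto simp: normal_element_def)
    have nc: "n \<in> carrier M" using n(1) ND(1) by blast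
    have "a \<odot>\<^bsub>M\<^esub> v = (a \<otimes> z) \<odot>\<^bsub>M\<^esub> n"
      using smult_assoc1[OF a zc nc] n(2) by simp
    also have "\<dots> = z \<odot>\<^bsub>M\<^esub> (b \<odot>\<^bsub>M\<^esub> n)"
      using smult_assoc1[OF zc b(1) nc] b(2) by simp
    finally show ?thesis using ND(4)[OF b(1) n(1)] by blast
  qed
qed

lemma submodule_vimage_normal:
  assumes z: "normal_element R z" and N: "submodule N R M"
  shows "submodule {v \<in> carrier M. z \<odot>\<^bsub>M\<^esub> v \<in> N} R M"
proof (rule submoduleI)
  have zc: "z \<in> carrier R" using z by (simp add: normal_element_def)
  show "a \<odot>\<^bsub>M\<^esub> v \<in> {v \<in> carrier M. z \<odot>\<^bsub>M\<^esub> v \<in> N}"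
    if a: "a \<in> carrier R" and v: "v \<in> {v \<in> carrier M. z \<odot>\<^bsub>M\<^esub> v \<in> N}" for a v
  proof -
    obtain b where b: "b \<in> carrier R" "z \<otimes> a = b \<otimes> z"
      using z a by (auto simp: normal_element_def)
    have "z \<odot>\<^bsub>M\<^esub> (a \<odot>\<^bsub>M\<^esub> v) = (z \<otimes> a) \<odot>\<^bsub>M\<^esub> v"
      using smult_assoc1[OF zc a, of v] v by simp
    also have "\<dots> = b \<odot>\<^bsub>M\<^esub> (z \<odot>\<^bsub>M\<^esub> v)"
      using smult_assoc1[OF b(1) zc, of v] b(2) v by simp
    finally show ?thesis using b(1) v a submoduleD(4)[OF N] by simp
  qed
qed (use z in \<open>auto simp: normal_element_def smult_r_distr submoduleD[OF N]\<close>)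

end

lemma (in irreducible_module) normal_image_eq_carrier:
  assumes "normal_element R z"
    and "\<And>v. \<lbrakk>v \<in> carrier M; z \<odot>\<^bsub>M\<^esub> v = \<zero>\<^bsub>M\<^esub>\<rbrakk> \<Longrightarrow> v = \<zero>\<^bsub>M\<^esub>"
  shows "(\<lambda>v. z \<odot>\<^bsub>M\<^esub> v) ` carrier M = carrier M"
proof -
  have "(\<lambda>v. z \<odot>\<^bsub>M\<^esub> v) ` carrier M \<noteq> {\<zero>\<^bsub>M\<^esub>}"
    using assms(2) nontrivial M.zero_closed by blast
  then show ?thesis
    using submodule_trivial[OF submodule_image_normal[OF assms(1) submodule_carrier]] by blast
qed

text \<open>The preimages of \<open>N\<close> under the powers of \<open>z\<close> increase and stop
  at a finite stage, which serves as \<open>P\<close>. Having only finitely many preimages to undo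
  is what carries \<open>P = carrier M\<close> back to \<open>N\<close>.\<close>

lemma (in noetherian_module) normal_saturation:
  assumes z: "normal_element R z" and zM: "(\<lambda>v. z \<odot>\<^bsub>M\<^esub> v) ` carrier M = carrier M"
    and N: "submodule N R M"
  obtains P where "submodule P R M" "N \<subseteq> P" "(\<lambda>v. z \<odot>\<^bsub>M\<^esub> v) ` P = P"
    "P = carrier M \<Longrightarrow> N = carrier M"
proof -
  have zc: "z \<in> carrier R" using z by (simp add: normal_element_def)
  define F where "F P = {v \<in> carrier M. z \<odot>\<^bsub>M\<^esub> v \<in> P}" for P
  define C where "C k = (F ^^ k) N" for k
  have C0: "C 0 = N" and CS: "C (Suc k) = F (C k)" for k by (simp_all add: C_def)
  have sub: "submodule (C k) R M" for k
    by (induction k) (simp_all add: C0 CS N F_def submodule_vimage_normal[OF z])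
  \<comment> \<open>A submodule is stable under \<open>z\<close>, hence lies in its own
    preimage.\<close>
  have le: "C k \<subseteq> C (Suc k)" for k
    using submoduleD(1,4)[OF sub[of k]] zc by (auto simp: CS F_def)
  obtain n where n: "\<forall>m\<ge>n. C m = C n"
    using ascending_chain_condition[of C, OF sub le] by blast
  then have stable: "C (Suc n) = C n" using le_SucI[OF order_refl] by blast
  have "C 0 \<subseteq> C n" by (rule lift_Suc_mono_le[of C, OF le]) simp
  moreover have "(\<lambda>v. z \<odot>\<^bsub>M\<^esub> v) ` C n = C n"
  proof
    show "(\<lambda>v. z \<odot>\<^bsub>M\<^esub> v) ` C n \<subseteq> C n" using submoduleD(4)[OF sub] zc by auto
    show "C n \<subseteq> (\<lambda>v. z \<odot>\<^bsub>M\<^esub> v) ` C n"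
    proof
      fix v assume v: "v \<in> C n"
      \<comment> \<open>Surjectivity of \<open>z\<close> supplies \<open>w\<close>, which lies in
        the next member of the chain and so already in \<open>C n\<close>.\<close>
      then obtain w where w: "w \<in> carrier M" "v = z \<odot>\<^bsub>M\<^esub> w"
        using submoduleD(1)[OF sub] zM by blast
      then have "w \<in> C (Suc n)" using v by (simp add: CS F_def)
      then show "v \<in> (\<lambda>v. z \<odot>\<^bsub>M\<^esub> v) ` C n" using w stable by blast
    qed
  qed
  moreover have "C k = carrier M \<Longrightarrow> N = carrier M" for k
  proof (induction k)
    case (Suc k)
    \<comment> \<open>One preimage is undone: \<open>z\<close> maps everything into
      \<open>C k\<close>, and \<open>z\<close> is surjective.\<close>
    then have "(\<lambda>v. z \<odot>\<^bsub>M\<^esub> v) ` carrier M \<subseteq> C k" by (auto simp: CS F_def)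
    then show ?case using Suc.IH zM submoduleD(1)[OF sub[of k]] by auto
  qed (simp add: C0)
  ultimately show ?thesis using that[of "C n"] sub[of n] C0 by simp
qed


section \<open>Generators of \<open>A\<^sub>h\<close>\<close>

text \<open>A word is a product of generators, so properties preserved by sums and products need
  checking only on constants and the two generators.\<close>

lemma free_alg_gen_induct [case_names const gen mult add]:
  fixes p :: "('a::field) free_alg"
  assumes const: "\<And>c. P (free_const c)" and gen: "\<And>g. P (free_gen g)"
    and mult: "\<And>p q. P p \<Longrightarrow> P q \<Longrightarrow> P (p * q)" and add: "\<And>p q. P p \<Longrightarrow> P q \<Longrightarrow> P (p + q)"
  shows "P p"
proof (induction p rule: free_alg_induct)
  case (single w c)
  have word: "P (Poly_Mapping.single (Word l) 1)" for l
  proof (induction l)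
    case Nil
    show ?case using const[of 1] by (simp add: free_const_def zero_xy_word_def)
  next
    case (Cons g l)
    have "Poly_Mapping.single (Word (g # l)) (1::'a) = free_gen g * Poly_Mapping.single (Word l) 1"
      by (simp add: free_gen_def mult_single plus_xy_word_def)
    then show ?case using mult[OF gen Cons] by simp
  qed
  have "Poly_Mapping.single w c = free_const c * Poly_Mapping.single (Word (letters w)) 1"
    by (simp add: free_const_def mult_single)
  then show ?case using mult[OF const word, of c "letters w"] by simp
qed (rule add)

lemma A_class_closed [simp]: "A_class h p \<in> carrier (A_alg h)"
  by (simp add: carrier_A)

lemma A_class_mult_cong:
  "\<lbrakk>A_class h p = A_class h p'; A_class h q = A_class h q'\<rbrakk> \<Longrightarrow> A_class h (p * q) = A_class h (p' * q')"
  by (simp add: A_class_mult)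

lemma A_class_add_cong:
  "\<lbrakk>A_class h p = A_class h p'; A_class h q = A_class h q'\<rbrakk> \<Longrightarrow> A_class h (p + q) = A_class h (p' + q')"
  by (simp add: A_class_add)

text \<open>The representatives whose classes map \<open>N\<close> into itself are closed under sums
  and products.\<close>

lemma submodule_A_algI:
  assumes "left_module (A_alg h) M" and sub: "N \<subseteq> carrier M" and zero: "\<zero>\<^bsub>M\<^esub> \<in> N"
    and add: "\<And>v w. \<lbrakk>v \<in> N; w \<in> N\<rbrakk> \<Longrightarrow> v \<oplus>\<^bsub>M\<^esub> w \<in> N"
    and const: "\<And>c v. v \<in> N \<Longrightarrow> A_class h (free_const c) \<odot>\<^bsub>M\<^esub> v \<in> N"
    and gen: "\<And>g v. v \<in> N \<Longrightarrow> A_class h (free_gen g) \<odot>\<^bsub>M\<^esub> v \<in> N"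
  shows "submodule N (A_alg h) M"
proof -
  interpret left_module "A_alg h" M by fact
  have class_smult: "A_class h p \<odot>\<^bsub>M\<^esub> v \<in> N" if "v \<in> N" for p v
    using that
  proof (induction p arbitrary: v rule: free_alg_gen_induct)
    case (mult p q)
    have "v \<in> carrier M" using mult.prems sub by blast
    then have "A_class h (p * q) \<odot>\<^bsub>M\<^esub> v = A_class h p \<odot>\<^bsub>M\<^esub> (A_class h q \<odot>\<^bsub>M\<^esub> v)"
      by (simp add: A_class_mult smult_assoc1)
    then show ?case using mult.IH(1)[OF mult.IH(2)[OF mult.prems]] by simp
  next
    case (add p q)
    have "v \<in> carrier M" using add.prems sub by blast
    then have "A_class h (p + q) \<odot>\<^bsub>M\<^esub> v = A_class h p \<odot>\<^bsub>M\<^esub> v \<oplus>\<^bsub>M\<^esub> A_class h q \<odot>\<^bsub>M\<^esub> v"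
      by (simp add: A_class_add smult_l_distr)
    then show ?case using assms(4)[OF add.IH(1)[OF add.prems] add.IH(2)[OF add.prems]] by simp
  qed (use const gen in blast)+
  show ?thesis
  proof (rule submoduleI[OF sub zero add])
    show "a \<odot>\<^bsub>M\<^esub> v \<in> N" if "a \<in> carrier (A_alg h)" "v \<in> N" for a v
      using that class_smult by (auto simp only: carrier_A)
  qed
qed


section \<open>Normality of \<open>h\<close>\<close>

text \<open>Constants are central, so commuting with \<open>free_X\<close> passes to its powers and
  their linear combinations.\<close>

lemma free_poly_commute:
  assumes "s * free_X = free_X * s"
  shows "s * free_poly r = free_poly r * s"
proof -
  have "s * (free_const c * free_X ^ i) = free_const c * free_X ^ i * s" for c i
  proof -
    have "s * free_X ^ i = free_X ^ i * s"
      using power_commuting_commutes[of free_X s] assms by metis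
    then show ?thesis
      using free_const_commute[of c s] by (metis mult.assoc)
  qed
  then show ?thesis
    unfolding free_poly_def sum_distrib_left sum_distrib_right by simp
qed

text \<open>The witness \<open>s\<close> is the derivative of \<open>p\<close>, seen as a polynomial in \<open>x\<close>.\<close>

definition skew_derivable :: "('a::field) poly \<Rightarrow> 'a free_alg \<Rightarrow> bool"
  where "skew_derivable h p \<longleftrightarrow> p * free_X = free_X * p \<and>
    (\<exists>s. s * free_X = free_X * s \<and>
      A_class h (free_Y * p) = A_class h (p * free_Y + free_poly h * s))"

lemma skew_derivable_const: "skew_derivable h (free_const c)"
  unfolding skew_derivable_def
  using free_const_commute[of c] by (auto intro!: exI[of _ 0])

text \<open>With derivative \<open>1\<close> the required identity is the defining relation of the
  algebra.\<close>

lemma skew_derivable_X: "skew_derivable h free_X"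
  unfolding skew_derivable_def
  using A_relation[of h]
  by (intro conjI exI[of _ 1]) (simp_all add: A_of_poly_def A_class_add A_class_mult)

lemma skew_derivable_add:
  assumes "skew_derivable h p" "skew_derivable h q"
  shows "skew_derivable h (p + q)"
proof -
  obtain s t where st: "s * free_X = free_X * s" "t * free_X = free_X * t"
    "A_class h (free_Y * p) = A_class h (p * free_Y + free_poly h * s)"
    "A_class h (free_Y * q) = A_class h (q * free_Y + free_poly h * t)"
    using assms by (auto simp: skew_derivable_def)
  show ?thesis
    unfolding skew_derivable_def
    using assms st(1,2) A_class_add_cong[OF st(3,4)]
    by (auto simp: skew_derivable_def algebra_simps intro!: exI[of _ "s + t"])
qed

text \<open>Leibniz rule: the witness for the product is \<open>p * t + s * q\<close>.\<close>

lemma skew_derivable_mult: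
  assumes "skew_derivable h p" "skew_derivable h q"
  shows "skew_derivable h (p * q)"
proof -
  obtain s t where st: "s * free_X = free_X * s" "t * free_X = free_X * t"
    "A_class h (free_Y * p) = A_class h (p * free_Y + free_poly h * s)"
    "A_class h (free_Y * q) = A_class h (q * free_Y + free_poly h * t)"
    using assms by (auto simp: skew_derivable_def)
  have p: "p * free_X = free_X * p" and q: "q * free_X = free_X * q"
    using assms by (auto simp: skew_derivable_def)
  have "A_class h (free_Y * (p * q)) = A_class h ((p * free_Y + free_poly h * s) * q)"
    using A_class_mult_cong[OF st(3), of q q] by (simp add: mult.assoc)
  also have "\<dots> = A_class h (p * (free_Y * q) + free_poly h * s * q)"
    by (simp add: algebra_simps)
  also have "\<dots> = A_class h (p * (q * free_Y + free_poly h * t) + free_poly h * s * q)"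
    by (intro A_class_add_cong A_class_mult_cong st(4) refl)
  \<comment> \<open>Here \<open>free_poly h\<close> is pulled to the left past \<open>p\<close>,
    which commutes with \<open>free_X\<close>.\<close>
  also have "p * (q * free_Y + free_poly h * t) + free_poly h * s * q
      = p * q * free_Y + free_poly h * (p * t + s * q)"
    using free_poly_commute[OF p, of h] by (simp add: algebra_simps flip: mult.assoc)
  finally have eq: "A_class h (free_Y * (p * q))
      = A_class h (p * q * free_Y + free_poly h * (p * t + s * q))" .
  have comm: "a * b * free_X = free_X * (a * b)"
    if "a * free_X = free_X * a" "b * free_X = free_X * b" for a b :: "'a free_alg"
    using that by (metis mult.assoc)
  have "(p * t + s * q) * free_X = free_X * (p * t + s * q)"
    using comm[OF p st(2)] comm[OF st(1) q] by (simp add: distrib_left distrib_right)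
  then show ?thesis
    unfolding skew_derivable_def using eq comm[OF p q] by blast
qed

lemma skew_derivable_poly: "skew_derivable h (free_poly r)"
proof -
  have pow: "skew_derivable h (free_X ^ i)" for i
    by (induction i)
      (use skew_derivable_const[of h 1] in \<open>simp_all add: skew_derivable_X skew_derivable_mult\<close>)
  have "skew_derivable h (\<Sum>i\<in>I. free_const (coeff r i) * free_X ^ i)" if "finite I" for I
    using that
    by (induction I) (use skew_derivable_const[of h 0] in
      \<open>simp_all add: skew_derivable_add skew_derivable_mult skew_derivable_const pow\<close>)
  then show ?thesis by (simp add: free_poly_def)
qed

text \<open>With \<open>s\<close> the derivative of \<open>h\<close>, modulo the relation
  \<open>y h = h (y + s)\<close> and, since \<open>s\<close> commutes with \<open>h\<close>, also
  \<open>h y = (y - s) h\<close>. The generator \<open>x\<close> commutes with \<open>h\<close>, and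
  products and sums follow.\<close>

lemma normal_element_A_of_poly: "normal_element (A_alg h) (A_of_poly h h)"
proof -
  let ?H = "free_poly h"
  obtain s where s: "s * free_X = free_X * s"
    "A_class h (free_Y * ?H) = A_class h (?H * free_Y + ?H * s)"
    using skew_derivable_poly[of h h] by (auto simp: skew_derivable_def)
  have sH: "s * ?H = ?H * s" by (rule free_poly_commute[OF s(1)])
  have XH: "free_X * ?H = ?H * free_X" by (simp add: free_poly_commute_X)
  have YH: "A_class h (free_Y * ?H) = A_class h (?H * (free_Y + s))"
    using s(2) by (simp add: distrib_left)
  have HY: "A_class h (?H * free_Y) = A_class h ((free_Y - s) * ?H)"
  proof -
    have "A_class h ((free_Y - s) * ?H) = A_class h (?H * free_Y)"
      using s(2) sH by (simp add: A_class_eq_iff algebra_simps)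
    then show ?thesis by simp
  qed
  have right: "\<exists>q. A_class h (p * ?H) = A_class h (?H * q)" for p
  proof (induction p rule: free_alg_gen_induct)
    case (const c)
    then show ?case using free_const_commute by metis
  next
    case (gen g)
    then show ?case using YH XH by (cases g) metis+
  next
    \<comment> \<open>The factor \<open>?H\<close> moves leftwards, first past \<open>q\<close> and
      then past \<open>p\<close>.\<close>
    case (mult p q)
    then obtain p' q' where pq: "A_class h (p * ?H) = A_class h (?H * p')"
      "A_class h (q * ?H) = A_class h (?H * q')" by blast
    have "A_class h (p * q * ?H) = A_class h (p * ?H * q')"
      using A_class_mult_cong[OF refl pq(2), of p] by (simp add: mult.assoc)
    also have "\<dots> = A_class h (?H * (p' * q'))"
      using A_class_mult_cong[OF pq(1) refl, of q'] by (simp add: mult.assoc)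
    finally show ?case by blast
  next
    case (add p q)
    then obtain p' q' where "A_class h (p * ?H) = A_class h (?H * p')"
      "A_class h (q * ?H) = A_class h (?H * q')" by blast
    from A_class_add_cong[OF this] have "A_class h ((p + q) * ?H) = A_class h (?H * (p' + q'))"
      by (simp only: distrib_left distrib_right)
    then show ?case by blast
  qed
  have left: "\<exists>q. A_class h (?H * p) = A_class h (q * ?H)" for p
  proof (induction p rule: free_alg_gen_induct)
    case (const c)
    then show ?case using free_const_commute by metis
  next
    case (gen g)
    then show ?case using HY XH by (cases g) metis+
  next
    case (mult p q)
    then obtain p' q' where pq: "A_class h (?H * p) = A_class h (p' * ?H)"
      "A_class h (?H * q) = A_class h (q' * ?H)" by blast
    have "A_class h (?H * (p * q)) = A_class h (p' * (?H * q))"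
      using A_class_mult_cong[OF pq(1) refl, of q] by (simp add: mult.assoc)
    also have "\<dots> = A_class h (p' * q' * ?H)"
      using A_class_mult_cong[OF refl pq(2), of p'] by (simp add: mult.assoc)
    finally show ?case by blast
  next
    case (add p q)
    then obtain p' q' where "A_class h (?H * p) = A_class h (p' * ?H)"
      "A_class h (?H * q) = A_class h (q' * ?H)" by blast
    from A_class_add_cong[OF this] have "A_class h (?H * (p + q)) = A_class h ((p' + q') * ?H)"
      by (simp only: distrib_left distrib_right)
    then show ?case by blast
  qed
  show ?thesis
    using left right
    by (fastforce simp: normal_element_def carrier_A A_of_poly_def simp flip: A_class_mult)
qed


section \<open>Restriction from the Weyl algebra\<close>

lemma restrict_scalars_sel [simp]:
  "carrier (restrict_scalars \<phi> M) = carrier M"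
  "\<zero>\<^bsub>restrict_scalars \<phi> M\<^esub> = \<zero>\<^bsub>M\<^esub>"
  "v \<oplus>\<^bsub>restrict_scalars \<phi> M\<^esub> w = v \<oplus>\<^bsub>M\<^esub> w"
  "a \<odot>\<^bsub>restrict_scalars \<phi> M\<^esub> v = \<phi> a \<odot>\<^bsub>M\<^esub> v"
  by (simp_all add: restrict_scalars_def)

lemma weyl_submodule_of_restriction:
  assumes M: "left_module weyl M"
    and N: "submodule N (A_alg h) (restrict_scalars (A_embed h) M)"
    and hN: "(\<lambda>v. A_of_poly 1 h \<odot>\<^bsub>M\<^esub> v) ` N = N"
  shows "submodule N weyl M"
proof -
  interpret M: left_module weyl M by fact
  interpret L: left_module "A_alg h" "restrict_scalars (A_embed h) M"
    by (rule left_module_restrict_scalars[OF ring_A M A_embed_ring_hom])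
  note ND = L.submoduleD[OF N, simplified]
  show ?thesis
  proof (rule submodule_A_algI[OF M])
    show "A_class 1 (free_const c) \<odot>\<^bsub>M\<^esub> v \<in> N" if "v \<in> N" for c v
      using ND(4)[OF A_class_closed that, of "free_const c"] by (simp add: A_embed_class)
    show "A_class 1 (free_gen g) \<odot>\<^bsub>M\<^esub> v \<in> N" if v: "v \<in> N" for g v
    proof (cases g)
      case GX
      then show ?thesis using ND(4)[OF A_class_closed v, of free_X] by (simp add: A_embed_x)
    next
      case GY
      \<comment> \<open>Dividing by \<open>h\<close> inside \<open>N\<close> turns the Weyl
        generator into \<open>y h\<close>, the image of \<open>A_y h\<close>.\<close>
      obtain w where w: "w \<in> N" "v = A_of_poly 1 h \<odot>\<^bsub>M\<^esub> w" using v hN by auto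
      then have "A_y 1 \<odot>\<^bsub>M\<^esub> v = A_embed h (A_y h) \<odot>\<^bsub>M\<^esub> w"
        using ND(1) M.smult_assoc1[of "A_y 1" "A_of_poly 1 h" w]
        by (auto simp: A_embed_y A_of_poly_def)
      then show ?thesis using GY ND(4)[OF A_class_closed w(1)] by simp
    qed
  qed (use ND in auto)
qed

theorem proposition6p12:
  fixes h :: "'a::field_char_0 poly"
    and M :: "('a free_alg set, 'm) module"
  assumes "h \<noteq> 0"
    and "irreducible_module weyl M"
    and "torsion_free M"
  shows "(irreducible_module (A_alg h) (restrict_scalars (A_embed h) M)
            \<longleftrightarrow> socle (A_alg h) (restrict_scalars (A_embed h) M) \<noteq> {\<zero>\<^bsub>M\<^esub>}) \<and>
         (socle (A_alg h) (restrict_scalars (A_embed h) M) \<noteq> {\<zero>\<^bsub>M\<^esub>}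
            \<longleftrightarrow> (\<lambda>v. A_of_poly 1 h \<odot>\<^bsub>M\<^esub> v) ` carrier M = carrier M \<and>
                noetherian_module (A_alg h) (restrict_scalars (A_embed h) M))"
proof -
  let ?L = "restrict_scalars (A_embed h) M"
  let ?hM = "(\<lambda>v. A_of_poly 1 h \<odot>\<^bsub>M\<^esub> v) ` carrier M = carrier M"
  interpret M: irreducible_module weyl M by fact
  interpret L: left_module "A_alg h" ?L
    by (rule left_module_restrict_scalars[OF ring_A M.left_module_axioms A_embed_ring_hom])
  have inj: "v = \<zero>\<^bsub>M\<^esub>" if "v \<in> carrier M" "A_of_poly 1 h \<odot>\<^bsub>M\<^esub> v = \<zero>\<^bsub>M\<^esub>" for v
    using assms(1,3) that by (auto simp: torsion_free_def)
  note normal = normal_element_A_of_poly[of h]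
  have dichotomy: "N = {\<zero>\<^bsub>M\<^esub>} \<or> N = carrier M"
    if "submodule N (A_alg h) ?L" "(\<lambda>v. A_of_poly 1 h \<odot>\<^bsub>M\<^esub> v) ` N = N" for N
    using M.submodule_trivial weyl_submodule_of_restriction[OF M.left_module_axioms that] by blast
  \<comment> \<open>(ii) implies (i): any irreducible submodule turns out to be all of
    \<open>M\<close>.\<close>
  have socle: "irreducible_module (A_alg h) ?L"
    if nz: "socle (A_alg h) ?L \<noteq> {\<zero>\<^bsub>M\<^esub>}"
  proof -
    obtain N where N: "submodule N (A_alg h) ?L"
      and irr: "irreducible_module (A_alg h) (?L\<lparr>carrier := N\<rparr>)"
      using L.socle_nonzero_imp_irreducible_submodule nz by auto
    interpret N: irreducible_module "A_alg h" "?L\<lparr>carrier := N\<rparr>" by fact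
    \<comment> \<open>The action of \<open>h\<close> on \<open>N\<close> is injective, and through
      the embedding it is the action of the normal element \<open>A_of_poly h h\<close>.\<close>
    have "(\<lambda>v. A_of_poly 1 h \<odot>\<^bsub>M\<^esub> v) ` N = N"
      using N.normal_image_eq_carrier[OF normal] inj L.submoduleD(1)[OF N]
      by (auto simp: A_embed_of_poly)
    then have "N = carrier ?L"
      using dichotomy[OF N] N.nontrivial by auto
    then show ?thesis using irr by (simp add: restrict_scalars_def)
  qed
  have ?hM if "irreducible_module (A_alg h) ?L"
    using irreducible_module.normal_image_eq_carrier[OF that normal] inj
    by (auto simp: A_embed_of_poly)
  \<comment> \<open>(iii) implies (i), by saturating an arbitrary submodule.\<close>
  moreover have "irreducible_module (A_alg h) ?L"
    if hM: ?hM and noeth: "noetherian_module (A_alg h) ?L"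
  proof
    interpret noetherian_module "A_alg h" ?L by fact
    show "carrier ?L \<noteq> {\<zero>\<^bsub>?L\<^esub>}" using M.nontrivial by simp
    fix N assume N: "submodule N (A_alg h) ?L"
    obtain P where P: "submodule P (A_alg h) ?L" "N \<subseteq> P"
      "(\<lambda>v. A_of_poly 1 h \<odot>\<^bsub>M\<^esub> v) ` P = P" "P = carrier M \<Longrightarrow> N = carrier M"
      using normal_saturation[OF normal _ N] hM by (auto simp: A_embed_of_poly)
    \<comment> \<open>If \<open>P\<close> is zero then so is \<open>N\<close>, being contained in
      it; if \<open>P\<close> is everything, saturation gives the same for \<open>N\<close>.\<close>
    show "N = {\<zero>\<^bsub>?L\<^esub>} \<or> N = carrier ?L"
      using dichotomy[OF P(1,3)] P(2,4) L.submoduleD(2)[OF N] by auto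
  qed
  moreover have "socle (A_alg h) ?L \<noteq> {\<zero>\<^bsub>M\<^esub>}" if "irreducible_module (A_alg h) ?L"
    using irreducible_module.socle_nonzero[OF that] by simp
  \<comment> \<open>This is the second half of (i) implies (iii).\<close>
  moreover note irreducible_module.noetherian[of "A_alg h" ?L]
  ultimately show ?thesis using socle by blast
qed

end
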